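(* There is a RAM algorithm which, given as input a finite monoid presentation $\langle \mathscr{A} \mid \mathscr{R} \rangle$, decides in time $O(|\mathscr{R}|^2)$ whether the presentation satisfies the condition $C(4)$.
   Context: Words are elements of the free monoid $\mathscr{A}^*$, with empty word $\epsilon$. A relation word is a word occurring as one side of a relation of the presentation. A piece is a word which occurs as a factor in sides of two different relations, or as a factor of both sides of a relation, or in two different (possibly overlapping) places within one side of a relation; by convention $\epsilon$ is always a piece. The presentation satisfies $C(n)$ if no relation word can be written as a product of strictly fewer than $n$ pieces ($\epsilon$ being the product of zero pieces). $|\mathscr{R}|$ denotes the sum of the lengths of the relation words in $\mathscr{R}$ (a value $0$ being read as $1$ in the $O$-estimate). In the RAM model used, elementary operations involving generators (such as comparing two generators) are single steps performable in constant time. *)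

theory Defs
  imports "HOL-Library.Sublist"
begin

section \<open>Monoid presentations, pieces and the conditions C(n)\<close>

text \<open>
  The relations form a set of ordered pairs of words over the alphabet, so two relations
  are different iff they differ as ordered pairs.
\<close>

type_synonym 'a relation = "'a list \<times> 'a list"

definition finite_presentation :: "'a set \<Rightarrow> 'a relation set \<Rightarrow> bool" where
  "finite_presentation A R \<longleftrightarrow> finite A \<and> finite R \<and> R \<subseteq> lists A \<times> lists A"

definition sides :: "'a relation \<Rightarrow> 'a list set" where
  "sides r = {fst r, snd r}"

definition relation_words :: "'a relation set \<Rightarrow> 'a list set" where
  "relation_words R = (\<Union>r\<in>R. sides r)"

text \<open>
  The predicate \<open>sublist\<close> is the contiguous one, i.e. the factor relation on words.
  A place of \<open>p\<close> in \<open>w\<close> is given by the prefix of \<open>w\<close> preceding it.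
\<close>

definition piece :: "'a relation set \<Rightarrow> 'a list \<Rightarrow> bool" where
  "piece R p \<longleftrightarrow>
     p = [] \<or>
     (\<exists>r\<in>R. \<exists>s\<in>R. r \<noteq> s \<and> (\<exists>u\<in>sides r. sublist p u) \<and> (\<exists>v\<in>sides s. sublist p v)) \<or>
     (\<exists>r\<in>R. sublist p (fst r) \<and> sublist p (snd r)) \<or>
     (\<exists>w\<in>relation_words R. \<exists>x y x' y'. w = x @ p @ y \<and> w = x' @ p @ y' \<and> x \<noteq> x')"

definition satisfies_C :: "nat \<Rightarrow> 'a relation set \<Rightarrow> bool" where
  "satisfies_C n R \<longleftrightarrow>
     \<not> (\<exists>w\<in>relation_words R. \<exists>ps. length ps < n \<and> (\<forall>p\<in>set ps. piece R p) \<and> w = concat ps)"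

definition relations_length :: "'a relation set \<Rightarrow> nat" where
  "relations_length R = (\<Sum>(u, v)\<in>R. length u + length v)"

section \<open>Random access machines\<close>

text \<open>
  A unit-cost RAM over the natural numbers with addition and truncated subtraction, but no
  multiplication. A program mentions finitely many registers; the memory is addressed only
  through registers. Both registers and memory cells are indexed by and contain natural
  numbers.
\<close>

datatype instr =
    Const nat nat             \<comment> \<open>\<open>Const r n\<close>: \<open>r := n\<close>\<close>
  | Move nat nat              \<comment> \<open>\<open>Move r s\<close>: \<open>r := s\<close>\<close>
  | Add nat nat nat           \<comment> \<open>\<open>Add r s t\<close>: \<open>r := s + t\<close>\<close>
  | Sub nat nat nat           \<comment> \<open>\<open>Sub r s t\<close>: \<open>r := s - t\<close>\<close>
  | Load nat nat              \<comment> \<open>\<open>Load r s\<close>: \<open>r := mem[s]\<close>\<close>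
  | Store nat nat             \<comment> \<open>\<open>Store r s\<close>: \<open>mem[r] := s\<close>\<close>
  | Jump nat
  | JumpEq nat nat nat        \<comment> \<open>\<open>JumpEq r s l\<close>: if \<open>r = s\<close> goto \<open>l\<close>\<close>
  | JumpLess nat nat nat      \<comment> \<open>\<open>JumpLess r s l\<close>: if \<open>r < s\<close> goto \<open>l\<close>\<close>
  | Halt bool                 \<comment> \<open>stop with the given answer\<close>

type_synonym ram_program = "instr list"

text \<open>Program counter, registers, memory.\<close>

type_synonym config = "nat \<times> (nat \<Rightarrow> nat) \<times> (nat \<Rightarrow> nat)"

fun exec :: "instr \<Rightarrow> config \<Rightarrow> config" where
  "exec (Const r n) (pc, reg, mem) = (Suc pc, reg(r := n), mem)"
| "exec (Move r s) (pc, reg, mem) = (Suc pc, reg(r := reg s), mem)"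
| "exec (Add r s t) (pc, reg, mem) = (Suc pc, reg(r := reg s + reg t), mem)"
| "exec (Sub r s t) (pc, reg, mem) = (Suc pc, reg(r := reg s - reg t), mem)"
| "exec (Load r s) (pc, reg, mem) = (Suc pc, reg(r := mem (reg s)), mem)"
| "exec (Store r s) (pc, reg, mem) = (Suc pc, reg, mem(reg r := reg s))"
| "exec (Jump l) (pc, reg, mem) = (l, reg, mem)"
| "exec (JumpEq r s l) (pc, reg, mem) = (if reg r = reg s then l else Suc pc, reg, mem)"
| "exec (JumpLess r s l) (pc, reg, mem) = (if reg r < reg s then l else Suc pc, reg, mem)"
| "exec (Halt b) (pc, reg, mem) = (pc, reg, mem)"

text \<open>
  A configuration whose program counter has left the program is stuck; it does not count as
  having halted.
\<close>

definition step :: "ram_program \<Rightarrow> config \<Rightarrow> config" where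
  "step P c = (if fst c < length P then exec (P ! fst c) c else c)"

definition initial_config :: "nat list \<Rightarrow> config" where
  "initial_config input =
     (0, \<lambda>_. 0, \<lambda>i. if i < length input then input ! i else 0)"

text \<open>
  After at most \<open>t\<close> steps on the given input, the program has stopped with answer \<open>b\<close>
  (a halted configuration is a fixed point of \<open>step\<close>).
\<close>

definition answers_within :: "ram_program \<Rightarrow> nat list \<Rightarrow> nat \<Rightarrow> bool \<Rightarrow> bool" where
  "answers_within P input t b \<longleftrightarrow>
     (let pc = fst ((step P ^^ t) (initial_config input))
      in pc < length P \<and> P ! pc = Halt b)"

section \<open>Presentations as input\<close>

text \<open>
  Generators are arbitrary natural numbers, each occupying a single memory cell, so that
  comparing two generators is a single step. Words and lists are preceded by their lengths.
\<close>

definition encode_word :: "nat list \<Rightarrow> nat list" where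
  "encode_word w = length w # w"

definition encode_presentation :: "nat list \<Rightarrow> nat relation list \<Rightarrow> nat list" where
  "encode_presentation as rs =
     encode_word as @ length rs # concat (map (\<lambda>(u, v). encode_word u @ encode_word v) rs)"

text \<open>
  The generators and the relations may be listed in any order, but without repetition. A
  running time bounded in terms of the relations alone is possible because the alphabet,
  whose size is not bounded in terms of them, can be skipped using its length.
\<close>

definition encodes_presentation :: "nat list \<Rightarrow> nat set \<Rightarrow> nat relation set \<Rightarrow> bool" where
  "encodes_presentation input A R \<longleftrightarrow>
     (\<exists>as rs. distinct as \<and> set as = A \<and> distinct rs \<and> set rs = R \<and>
              input = encode_presentation as rs)"

end

theory Submission
  imports Defs
begin

text \<open>
  Factors of pieces are pieces, so a relation word is a product of at most three pieces iff three
  greedy steps, each removing the longest prefix that is a piece, exhaust it. A nonempty word is a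
  piece iff it occurs at two different places in the list of all sides of the relations. Hence the
  longest piece starting at a given letter is found by comparing the rest of its word letter by
  letter with the text starting at every other letter. For a word of length \<open>n\<close> a greedy step
  costs \<open>O((n + 1) S)\<close>, where \<open>S\<close> is the length of the encoded sides, and summing over all words
  gives \<open>O(S\<^sup>2)\<close>. Finally \<open>S\<close> is linear in the length of the relations, since at most one
  relation is \<open>(\<epsilon>, \<epsilon>)\<close>. The memory is only read.
\<close>

section \<open>Pieces and greedy factorisations\<close>

fun suffixes_at :: "nat \<Rightarrow> 'a list \<Rightarrow> (nat \<times> 'a list) set" where
  "suffixes_at j [] = {}"
| "suffixes_at j (a # t) = insert (j, a # t) (suffixes_at (Suc j) t)"

text \<open>\<open>Suc\<close> steps over the length cell in front of each word, so the first
  components are memory addresses of letters.\<close>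

fun all_suffixes_at :: "nat \<Rightarrow> 'a list list \<Rightarrow> (nat \<times> 'a list) set" where
  "all_suffixes_at j [] = {}"
| "all_suffixes_at j (w # ws) =
     suffixes_at (Suc j) w \<union> all_suffixes_at (Suc (j + length w)) ws"

text \<open>Address of the length cell of the \<open>k\<close>-th word when the encoded words start at address \<open>j\<close>.\<close>

definition header :: "nat \<Rightarrow> 'a list list \<Rightarrow> nat \<Rightarrow> nat" where
  "header j ws k = j + (\<Sum>w\<leftarrow>take k ws. Suc (length w))"

lemma suffixes_at_eq: "suffixes_at j t = {(j + i, drop i t) | i. i < length t}"
proof (induction t arbitrary: j)
  case (Cons a t)
  show ?case
    unfolding suffixes_at.simps Cons.IH
    by (auto simp: less_Suc_eq_0_disj intro: exI[of _ 0])
qed simp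

lemma all_suffixes_at_eq:
  "all_suffixes_at j ws =
     {(Suc (header j ws k) + i, drop i (ws ! k)) | k i. k < length ws \<and> i < length (ws ! k)}"
proof (induction ws arbitrary: j)
  case (Cons w ws)
  have ex_nat: "(\<exists>k. P k) \<longleftrightarrow> P 0 \<or> (\<exists>k. P (Suc k))" for P :: "nat \<Rightarrow> bool"
    by (metis not0_implies_Suc)
  have header_simps: "header j (w # ws) 0 = j"
      "header j (w # ws) (Suc k) = header (Suc (j + length w)) ws k" for k
    by (simp_all add: header_def)
  show ?case
    unfolding all_suffixes_at.simps Cons.IH suffixes_at_eq set_eq_iff Un_iff mem_Collect_eq
    by (subst (2) ex_nat) (simp add: header_simps)
qed simp

lemma header_add_less:
  assumes "k < k'" "k' < length ws" "i < length (ws ! k)"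
  shows "header j ws k + i < header j ws k'"
proof -
  have "take k' ws = take k ws @ ws ! k # drop (Suc k) (take k' ws)"
    using assms id_take_nth_drop[of k "take k' ws"] by (simp add: min_def)
  then have "(\<Sum>w\<leftarrow>take k' ws. Suc (length w)) =
     (\<Sum>w\<leftarrow>take k ws. Suc (length w)) + Suc (length (ws ! k))
       + (\<Sum>w\<leftarrow>drop (Suc k) (take k' ws). Suc (length w))"
    by (metis (no_types, lifting) add.assoc list.simps(9) map_append sum_list.Cons sum_list_append)
  then show ?thesis
    using assms(3) by (simp add: header_def)
qed

text \<open>Lets a single number identify a place in the text, so that the program recognises its
  own position by one comparison.\<close>

lemma letter_address_inj:
  assumes "k < length ws" "k' < length ws" "i < length (ws ! k)" "i' < length (ws ! k')"
  shows "Suc (header j ws k) + i = Suc (header j ws k') + i' \<longleftrightarrow> k = k' \<and> i = i'"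
  using assms header_add_less[of k k' ws i j] header_add_less[of k' k ws i' j]
  by (cases k k' rule: linorder_cases) auto

section \<open>Pieces as factors occurring at two places\<close>

definition word_list :: "'a relation list \<Rightarrow> 'a list list" where
  "word_list rs = concat (map (\<lambda>(u, v). [u, v]) rs)"

lemma length_word_list [simp]: "length (word_list rs) = 2 * length rs"
  by (induction rs) (auto simp: word_list_def)

lemma word_list_nth:
  "k < 2 * length rs \<Longrightarrow>
    word_list rs ! k = (if even k then fst (rs ! (k div 2)) else snd (rs ! (k div 2)))"
proof (induction rs arbitrary: k)
  case (Cons r rs)
  obtain u v where r: "r = (u, v)"
    by force
  consider "k = 0" | "k = 1" | k' where "k = Suc (Suc k')"
    by (metis One_nat_def not0_implies_Suc)
  then show ?case
    using Cons by cases (auto simp: r word_list_def)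
qed simp

lemma set_word_list: "set (word_list rs) = relation_words (set rs)"
  by (auto simp: word_list_def relation_words_def sides_def)

text \<open>Merges the three clauses for nonempty pieces: a place is a pair of word index and
  offset. Offsets past the end of a word are harmless, as only \<open>[]\<close> is a prefix
  there.\<close>

definition repeated :: "'a list list \<Rightarrow> 'a list \<Rightarrow> bool" where
  "repeated ws q \<longleftrightarrow>
     (\<exists>k i k' i'. k < length ws \<and> k' < length ws \<and> (k, i) \<noteq> (k', i') \<and>
        prefix q (drop i (ws ! k)) \<and> prefix q (drop i' (ws ! k')))"

lemma sublist_iff_prefix_drop: "sublist q w \<longleftrightarrow> (\<exists>i. prefix q (drop i w))"
proof
  assume "sublist q w"
  then obtain x y where "w = x @ q @ y"
    by (auto simp: sublist_def)
  then have "prefix q (drop (length x) w)"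
    by simp
  then show "\<exists>i. prefix q (drop i w)" ..
next
  assume "\<exists>i. prefix q (drop i w)"
  then show "sublist q w"
    by (metis prefix_imp_sublist sublist_drop sublist_order.order_trans)
qed

lemma sides_iff_word_list:
  assumes "i < length rs"
  shows "w \<in> sides (rs ! i) \<longleftrightarrow> w = word_list rs ! (2 * i) \<or> w = word_list rs ! Suc (2 * i)"
  using assms by (auto simp: sides_def word_list_nth)

text \<open>Different relations yield indices with different halves, the two sides of one relation
  an even and an odd index, and two places in one word different offsets.\<close>

lemma piece_imp_repeated:
  assumes "piece (set rs) q" "q \<noteq> []"
  shows "repeated (word_list rs) q"
proof -
  let ?ws = "word_list rs"
  have sideE: "\<exists>k i. k < length ?ws \<and> k div 2 = m \<and> prefix q (drop i (?ws ! k))"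
    if m: "m < length rs" and u: "u \<in> sides (rs ! m)" "sublist q u" for m u
  proof -
    obtain i where i: "prefix q (drop i u)"
      using u(2) by (auto simp: sublist_iff_prefix_drop)
    from u(1) consider "u = ?ws ! (2 * m)" | "u = ?ws ! Suc (2 * m)"
      unfolding sides_iff_word_list[OF m] by blast
    then show ?thesis
    proof cases
      case 1
      then show ?thesis
        using i m by (intro exI[of _ "2 * m"] exI[of _ i]) simp
    next
      case 2
      then show ?thesis
        using i m by (intro exI[of _ "Suc (2 * m)"] exI[of _ i]) simp
    qed
  qed
  consider
      r s u v where "r \<in> set rs" "s \<in> set rs" "r \<noteq> s"
        "u \<in> sides r" "sublist q u" "v \<in> sides s" "sublist q v"
    | r where "r \<in> set rs" "sublist q (fst r)" "sublist q (snd r)"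
    | w x y x' y' where "w \<in> set ?ws" "w = x @ q @ y" "w = x' @ q @ y'" "x \<noteq> x'"
    using assms unfolding piece_def set_word_list by blast
  then show ?thesis
  proof cases
    case 1
    obtain m n where mn: "m < length rs" "r = rs ! m" "n < length rs" "s = rs ! n"
      using 1 by (metis in_set_conv_nth)
    then have "m \<noteq> n"
      using 1 by auto
    moreover obtain k i where "k < length ?ws" "k div 2 = m" "prefix q (drop i (?ws ! k))"
      using sideE[of m u] 1 mn by blast
    moreover obtain k' i' where "k' < length ?ws" "k' div 2 = n" "prefix q (drop i' (?ws ! k'))"
      using sideE[of n v] 1 mn by blast
    ultimately show ?thesis
      unfolding repeated_def by blast
  next
    case 2
    obtain m where m: "m < length rs" "r = rs ! m"
      using 2 by (metis in_set_conv_nth)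
    obtain i i' where "prefix q (drop i (fst r))" "prefix q (drop i' (snd r))"
      using 2 by (auto simp: sublist_iff_prefix_drop)
    then show ?thesis
      unfolding repeated_def using m
      by (intro exI[of _ "2 * m"] exI[of _ i] exI[of _ "Suc (2 * m)"] exI[of _ i'])
        (simp add: word_list_nth)
  next
    case 3
    obtain k where k: "k < length ?ws" "w = ?ws ! k"
      using 3 by (metis in_set_conv_nth)
    have "prefix q (drop (length x) w)" "prefix q (drop (length x') w)"
      by (simp add: 3(2), simp add: 3(3))
    moreover have "length x \<noteq> length x'"
      using 3 by (metis append_eq_append_conv)
    ultimately show ?thesis
      unfolding repeated_def using k by blast
  qed
qed

text \<open>Comparing \<open>k div 2\<close> with \<open>k' div 2\<close> tells different relations
  from sides of the same one. Without \<open>distinct rs\<close>, a relation listed twice would make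
  all its factors repeated.\<close>

lemma repeated_imp_piece:
  assumes "distinct rs" "repeated (word_list rs) q" "q \<noteq> []"
  shows "piece (set rs) q"
proof -
  let ?ws = "word_list rs"
  obtain k i k' i' where k: "k < 2 * length rs" "k' < 2 * length rs" "(k, i) \<noteq> (k', i')"
    and p: "prefix q (drop i (?ws ! k))" "prefix q (drop i' (?ws ! k'))"
    using assms(2) unfolding repeated_def by auto
  have sub: "sublist q (?ws ! k)" "sublist q (?ws ! k')"
    using p by (auto simp: sublist_iff_prefix_drop)
  have side: "?ws ! l \<in> sides (rs ! (l div 2))" if "l < 2 * length rs" for l
    using that by (simp add: word_list_nth sides_def)
  have half: "k div 2 < length rs" "k' div 2 < length rs"
    using k by auto
  consider "k div 2 \<noteq> k' div 2" | "k div 2 = k' div 2" "k \<noteq> k'" | "k = k'" "i \<noteq> i'"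
    using k by blast
  then show ?thesis
  proof cases
    case 1
    then have "rs ! (k div 2) \<noteq> rs ! (k' div 2)"
      using assms(1) half by (simp add: nth_eq_iff_index_eq)
    then show ?thesis
      unfolding piece_def using half side k sub nth_mem by metis
  next
    case 2
    then have "even k \<noteq> even k'"
      by (metis dvd_mult_div_cancel even_Suc odd_two_times_div_two_succ)
    then have "sublist q (fst (rs ! (k div 2))) \<and> sublist q (snd (rs ! (k div 2)))"
      using sub k 2 by (auto simp: word_list_nth split: if_splits)
    then show ?thesis
      unfolding piece_def using half nth_mem by blast
  next
    case 3
    let ?w = "?ws ! k"
    \<comment> \<open>As \<open>q\<close> is nonempty, both offsets lie inside the word; hence the
      prefixes taken below have different lengths.\<close>
    have lt: "i < length ?w" "i' < length ?w"
      using p assms(3) 3 by (metis drop_all linorder_not_less prefix_bot.extremum_unique)+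
    obtain y y' where y: "drop i ?w = q @ y" "drop i' ?w = q @ y'"
      using p 3 by (auto simp: prefix_def)
    have "?w = take i ?w @ q @ y" "?w = take i' ?w @ q @ y'"
      by (metis append_take_drop_id y(1), metis append_take_drop_id y(2))
    moreover have "take i ?w \<noteq> take i' ?w"
      using lt 3 by (metis length_take min.absorb4)
    moreover have "?w \<in> relation_words (set rs)"
      using k by (simp flip: set_word_list)
    ultimately show ?thesis
      unfolding piece_def by blast
  qed
qed

lemma piece_iff_repeated:
  "distinct rs \<Longrightarrow> q \<noteq> [] \<Longrightarrow> piece (set rs) q \<longleftrightarrow> repeated (word_list rs) q"
  using piece_imp_repeated repeated_imp_piece by blast

text \<open>Each occurrence of \<open>q\<close> contains one of \<open>q'\<close> at a fixed offset,
  so different places of \<open>q\<close> give different places of \<open>q'\<close>.\<close>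

lemma piece_sublist: "piece R q \<Longrightarrow> sublist q' q \<Longrightarrow> piece R q'"
proof (cases "q' = []")
  case False
  assume q: "piece R q" "sublist q' q"
  have trans: "sublist q x \<Longrightarrow> sublist q' x" for x
    using q(2) sublist_order.order_trans by blast
  obtain a b where ab: "q = a @ q' @ b"
    using q(2) by (auto simp: sublist_def)
  have "q \<noteq> []"
    using ab False by simp
  then consider
      "\<exists>r\<in>R. \<exists>s\<in>R. r \<noteq> s \<and> (\<exists>u\<in>sides r. sublist q u) \<and> (\<exists>v\<in>sides s. sublist q v)"
    | "\<exists>r\<in>R. sublist q (fst r) \<and> sublist q (snd r)"
    | w x y x' y' where "w \<in> relation_words R" "w = x @ q @ y" "w = x' @ q @ y'" "x \<noteq> x'"
    using q(1) unfolding piece_def by blast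
  then show ?thesis
  proof cases
    case 1
    then show ?thesis
      unfolding piece_def using trans by meson
  next
    case 2
    then show ?thesis
      unfolding piece_def using trans by blast
  next
    case 3
    have "w = (x @ a) @ q' @ (b @ y)" "w = (x' @ a) @ q' @ (b @ y')" "x @ a \<noteq> x' @ a"
      using 3 ab by auto
    then show ?thesis
      unfolding piece_def using 3(1) by blast
  qed
qed (simp add: piece_def)

section \<open>Optimality of greedy factorisation\<close>

definition factorable :: "'a relation set \<Rightarrow> nat \<Rightarrow> 'a list \<Rightarrow> bool" where
  "factorable R n w \<longleftrightarrow> (\<exists>ps. length ps \<le> n \<and> (\<forall>p\<in>set ps. piece R p) \<and> w = concat ps)"

lemma satisfies_C_Suc: "satisfies_C (Suc n) R \<longleftrightarrow> (\<forall>w\<in>relation_words R. \<not> factorable R n w)"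
  unfolding satisfies_C_def factorable_def less_Suc_eq_le by blast

lemma factorable_0: "factorable R 0 w \<longleftrightarrow> w = []"
  by (auto simp: factorable_def)

lemma factorable_Suc:
  "factorable R (Suc n) w \<longleftrightarrow> (\<exists>p w'. piece R p \<and> w = p @ w' \<and> factorable R n w')"
proof
  assume "factorable R (Suc n) w"
  then obtain ps where ps: "length ps \<le> Suc n" "\<forall>p\<in>set ps. piece R p" "w = concat ps"
    by (auto simp: factorable_def)
  show "\<exists>p w'. piece R p \<and> w = p @ w' \<and> factorable R n w'"
  proof (cases ps)
    case Nil
    then show ?thesis
      \<comment> \<open>The empty product gets the dummy first piece \<open>[]\<close>.\<close>
      using ps by (intro exI[of _ "[]"]) (auto simp: factorable_def piece_def intro: exI[of _ "[]"])
  next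
    case (Cons p qs)
    then show ?thesis
      using ps by (auto simp: factorable_def)
  qed
next
  assume "\<exists>p w'. piece R p \<and> w = p @ w' \<and> factorable R n w'"
  then obtain p ps where "piece R p" "length ps \<le> n" "\<forall>p\<in>set ps. piece R p" "w = p @ concat ps"
    by (auto simp: factorable_def)
  then show "factorable R (Suc n) w"
    unfolding factorable_def by (intro exI[of _ "p # ps"]) auto
qed

text \<open>Cutting letters off the front replaces leading pieces by suffixes of them, which are
  pieces again. Having less left to factorise is never a disadvantage, which justifies the greedy
  choice.\<close>

lemma factorable_drop: "factorable R n w \<Longrightarrow> factorable R n (drop d w)"
proof (induction n arbitrary: w d)
  case 0
  then show ?case
    by (simp add: factorable_0)
next
  case (Suc n)
  then obtain p w' where "piece R p" "w = p @ w'" "factorable R n w'"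
    by (auto simp: factorable_Suc)
  moreover from this have "piece R (drop d p)" "factorable R n (drop (d - length p) w')"
    using piece_sublist sublist_drop Suc.IH by blast+
  ultimately show ?case
    unfolding factorable_Suc by auto
qed

text \<open>The first piece of any factorisation has at most \<open>l\<close> letters, so what
  follows the longest possible piece is a suffix of what follows that first piece.\<close>

lemma factorable_greedy:
  assumes "\<And>q. prefix q w \<Longrightarrow> piece R q \<longleftrightarrow> length q \<le> l" "l \<le> length w"
  shows "factorable R (Suc n) w \<longleftrightarrow> factorable R n (drop l w)"
proof
  assume "factorable R (Suc n) w"
  then obtain p w' where p: "piece R p" "w = p @ w'" "factorable R n w'"
    by (auto simp: factorable_Suc)
  then have "length p \<le> l"
    using assms(1)[of p] by simp
  then show "factorable R n (drop l w)"
    using p factorable_drop by simp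
next
  assume "factorable R n (drop l w)"
  moreover have "piece R (take l w)"
    using assms by (simp add: take_is_prefix)
  ultimately show "factorable R (Suc n) w"
    unfolding factorable_Suc by (metis append_take_drop_id)
qed

section \<open>The algorithm on lists\<close>

text \<open>\<open>p\<close> is the address of the current position, \<open>s\<close> the rest of
  its word, and \<open>best\<close> the furthest end of a match so far. Ends are addresses rather
  than lengths, as in the registers of the program.\<close>

fun scan_word :: "nat \<Rightarrow> 'a list \<Rightarrow> nat \<Rightarrow> 'a list \<Rightarrow> nat \<Rightarrow> nat" where
  "scan_word p s j [] best = best"
| "scan_word p s j (a # t) best =
     scan_word p s (Suc j) t
       (if j = p then best else max best (p + length (longest_common_prefix s (a # t))))"

fun scan :: "nat \<Rightarrow> 'a list \<Rightarrow> nat \<Rightarrow> 'a list list \<Rightarrow> nat \<Rightarrow> nat" where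
  "scan p s j [] best = best"
| "scan p s j (w # ws) best =
     scan p s (Suc (j + length w)) ws (scan_word p s (Suc j) w best)"

text \<open>Describing the result by the numbers \<open>d\<close> below it avoids a maximum over a
  set that may be empty.\<close>

lemma le_scan_word_iff:
  "d \<le> scan_word p s j t best \<longleftrightarrow>
     d \<le> best \<or>
     (\<exists>(j', t') \<in> suffixes_at j t. j' \<noteq> p \<and> d \<le> p + length (longest_common_prefix s t'))"
  by (induction p s j t best rule: scan_word.induct) auto

lemma le_scan_iff:
  "d \<le> scan p s j ws best \<longleftrightarrow>
     d \<le> best \<or>
     (\<exists>(j', t') \<in> all_suffixes_at j ws. j' \<noteq> p \<and> d \<le> p + length (longest_common_prefix s t'))"
  by (induction p s j ws best rule: scan.induct) (auto simp: le_scan_word_iff)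

lemma length_longest_common_prefix_le: "length (longest_common_prefix s t) \<le> length s"
  by (simp add: longest_common_prefix_prefix1 prefix_length_le)

lemma scan_bounds:
  shows "p \<le> scan p s j ws p" and "scan p s j ws p \<le> p + length s"
proof -
  show "p \<le> scan p s j ws p"
    by (simp add: le_scan_iff)
  \<comment> \<open>Taking \<open>d\<close> to be the value of the scan itself shows that it is
    attained.\<close>
  have "scan p s j ws p \<le> p \<or> (\<exists>t. scan p s j ws p \<le> p + length (longest_common_prefix s t))"
    using le_scan_iff[of "scan p s j ws p" p s j ws p] by auto
  then show "scan p s j ws p \<le> p + length s"
    using length_longest_common_prefix_le by (metis add_le_cancel_left le_add1 le_trans)
qed

lemma prefix_longest_common_prefix_iff:
  assumes "prefix q s"
  shows "length q \<le> length (longest_common_prefix s t) \<longleftrightarrow> prefix q t"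
proof
  assume "length q \<le> length (longest_common_prefix s t)"
  then have "prefix q (longest_common_prefix s t)"
    using assms longest_common_prefix_prefix1 prefix_length_prefix by blast
  then show "prefix q t"
    using longest_common_prefix_prefix2 prefix_order.order_trans by blast
next
  assume "prefix q t"
  then show "length q \<le> length (longest_common_prefix s t)"
    using assms longest_common_prefix_max_prefix prefix_length_le by blast
qed

text \<open>One occurrence of \<open>q\<close>, at address \<open>p\<close>, is known already, so a
  repetition amounts to an occurrence at any other address.\<close>

lemma repeated_iff_suffixes:
  assumes "q \<noteq> []" "(p, s) \<in> all_suffixes_at b ws" "prefix q s"
  shows "repeated ws q \<longleftrightarrow> (\<exists>(j, t)\<in>all_suffixes_at b ws. j \<noteq> p \<and> prefix q t)"
proof -
  obtain k i where ki: "k < length ws" "i < length (ws ! k)"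
      "p = Suc (header b ws k) + i" "s = drop i (ws ! k)"
    using assms(2) by (auto simp: all_suffixes_at_eq)
  show ?thesis
  proof
    assume "repeated ws q"
    then obtain k1 i1 k2 i2 where o: "k1 < length ws" "k2 < length ws" "(k1, i1) \<noteq> (k2, i2)"
        "prefix q (drop i1 (ws ! k1))" "prefix q (drop i2 (ws ! k2))"
      by (auto simp: repeated_def)
    \<comment> \<open>Of two different places at least one differs from
      \<open>(k, i)\<close>.\<close>
    obtain k' i' where o': "k' < length ws" "(k', i') \<noteq> (k, i)" "prefix q (drop i' (ws ! k'))"
      using o by metis
    have l: "i' < length (ws ! k')"
      using o'(3) assms(1) by (metis drop_all linorder_not_less prefix_bot.extremum_unique)
    have "(Suc (header b ws k') + i', drop i' (ws ! k')) \<in> all_suffixes_at b ws"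
      using o' l unfolding all_suffixes_at_eq by blast
    moreover have "Suc (header b ws k') + i' \<noteq> p"
      using letter_address_inj[of k' ws k i' i b] o' l ki by auto
    ultimately show "\<exists>(j, t)\<in>all_suffixes_at b ws. j \<noteq> p \<and> prefix q t"
      using o'(3) by (intro bexI[of _ "(Suc (header b ws k') + i', drop i' (ws ! k'))"]) auto
  next
    assume "\<exists>(j, t)\<in>all_suffixes_at b ws. j \<noteq> p \<and> prefix q t"
    then obtain k' i' where "k' < length ws" "i' < length (ws ! k')"
        "Suc (header b ws k') + i' \<noteq> p" "prefix q (drop i' (ws ! k'))"
      by (auto simp: all_suffixes_at_eq)
    then show "repeated ws q"
      unfolding repeated_def using ki assms(3)
      by (intro exI[of _ k] exI[of _ i] exI[of _ k'] exI[of _ i']) auto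
  qed
qed

text \<open>Correctness of a single greedy step. The alternative \<open>s = []\<close> covers a
  position where the word is exhausted and only the empty prefix remains.\<close>

lemma piece_iff_le_scan:
  assumes "distinct rs" "(p, s) \<in> all_suffixes_at b (word_list rs) \<or> s = []" "prefix q s"
  shows "piece (set rs) q \<longleftrightarrow> length q \<le> scan p s b (word_list rs) p - p"
proof (cases "q = []")
  case False
  then have s: "(p, s) \<in> all_suffixes_at b (word_list rs)"
    using assms by auto
  have "length q \<le> scan p s b (word_list rs) p - p \<longleftrightarrow> p + length q \<le> scan p s b (word_list rs) p"
    using scan_bounds(1)[of p s b "word_list rs"] by linarith
  also have "\<dots> \<longleftrightarrow> (\<exists>(j, t)\<in>all_suffixes_at b (word_list rs). j \<noteq> p \<and> prefix q t)"
    using False assms(3) by (simp add: le_scan_iff prefix_longest_common_prefix_iff)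
  finally show ?thesis
    using repeated_iff_suffixes[OF False s assms(3)] piece_iff_repeated[OF assms(1) False] by simp
qed (simp add: piece_def)

section \<open>Iterated greedy steps\<close>

fun greedy :: "nat \<Rightarrow> 'a list list \<Rightarrow> nat \<Rightarrow> nat \<Rightarrow> 'a list \<Rightarrow> nat" where
  "greedy b ws 0 p s = p"
| "greedy b ws (Suc n) p s =
     (let p' = scan p s b ws p in greedy b ws n p' (drop (p' - p) s))"

lemma greedy_eq_end_iff:
  assumes "distinct rs" "(p, s) \<in> all_suffixes_at b (word_list rs) \<or> s = []"
  shows "greedy b (word_list rs) n p s = p + length s \<longleftrightarrow> factorable (set rs) n s"
  using assms(2)
proof (induction n arbitrary: p s)
  case 0
  show ?case
    by (simp add: factorable_0)
next
  case (Suc n)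
  define l where "l = scan p s b (word_list rs) p - p"
  have l: "scan p s b (word_list rs) p = p + l" "l \<le> length s"
    using scan_bounds[of p s b "word_list rs"] by (auto simp: l_def)
  \<comment> \<open>Invariant of the iteration: the new position is again a letter address, or the
    word is exhausted.\<close>
  have "(p + l, drop l s) \<in> all_suffixes_at b (word_list rs) \<or> drop l s = []"
  proof (cases "l = length s")
    case False
    then obtain k i where "k < length (word_list rs)" "i < length (word_list rs ! k)"
        "p = Suc (header b (word_list rs) k) + i" "s = drop i (word_list rs ! k)"
      using Suc.prems l by (auto simp: all_suffixes_at_eq)
    moreover from this have "i + l < length (word_list rs ! k)"
      using l False by auto
    ultimately have "(p + l, drop l s) \<in> all_suffixes_at b (word_list rs)"
      unfolding all_suffixes_at_eq
      by (intro CollectI exI[of _ k] exI[of _ "i + l"]) (simp add: ac_simps)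
    then show ?thesis ..
  qed simp
  then have "greedy b (word_list rs) (Suc n) p s = p + length s \<longleftrightarrow> factorable (set rs) n (drop l s)"
    using Suc.IH[of "p + l" "drop l s"] l by simp
  also have "\<dots> \<longleftrightarrow> factorable (set rs) (Suc n) s"
    using factorable_greedy[of s "set rs" l n] piece_iff_le_scan[OF assms(1) Suc.prems] l l_def
    by blast
  finally show ?case .
qed

section \<open>The program\<close>

text \<open>The default \<open>0\<close> lets any list of zeros, even \<open>[]\<close>, stand for
  the initial registers.\<close>

definition registers :: "nat list \<Rightarrow> nat \<Rightarrow> nat" where
  "registers vs i = (if i < length vs then vs ! i else 0)"

text \<open>
  Execution is verified backwards: the lemmas about \<open>halts\<close> derive the final answer at the
  entry of a program fragment from the same answer at its exits, adding up the time on the way.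
\<close>

definition halts :: "ram_program \<Rightarrow> (nat \<Rightarrow> nat) \<Rightarrow> nat \<Rightarrow> nat \<Rightarrow> nat list \<Rightarrow> bool \<Rightarrow> bool" where
  "halts P mem t pc vs b \<longleftrightarrow>
     (let pc' = fst ((step P ^^ t) (pc, registers vs, mem)) in pc' < length P \<and> P ! pc' = Halt b)"

text \<open>Continuation style: \<open>k\<close> is the claim to be shown after the instruction, so
  rewriting executes the program symbolically on a list of register values. Memory is a fixed
  parameter, which is why \<open>Store\<close> yields \<open>False\<close>.\<close>

fun exec_list ::
  "instr \<Rightarrow> (nat \<Rightarrow> nat) \<Rightarrow> (nat \<Rightarrow> nat list \<Rightarrow> bool) \<Rightarrow> nat \<Rightarrow> nat list \<Rightarrow> bool" where
  "exec_list (Const r n) mem k pc vs = k (Suc pc) (vs[r := n])"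
| "exec_list (Move r s) mem k pc vs = k (Suc pc) (vs[r := vs ! s])"
| "exec_list (Add r s t) mem k pc vs = k (Suc pc) (vs[r := vs ! s + vs ! t])"
| "exec_list (Sub r s t) mem k pc vs = k (Suc pc) (vs[r := vs ! s - vs ! t])"
| "exec_list (Load r s) mem k pc vs = k (Suc pc) (vs[r := mem (vs ! s)])"
| "exec_list (Store r s) mem k pc vs = False"
| "exec_list (Jump l) mem k pc vs = k l vs"
| "exec_list (JumpEq r s l) mem k pc vs = (if vs ! r = vs ! s then k l vs else k (Suc pc) vs)"
| "exec_list (JumpLess r s l) mem k pc vs = (if vs ! r < vs ! s then k l vs else k (Suc pc) vs)"
| "exec_list (Halt b) mem k pc vs = k pc vs"

fun registers_below :: "nat \<Rightarrow> instr \<Rightarrow> bool" where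
  "registers_below l (Const r n) = (r < l)"
| "registers_below l (Move r s) = (r < l \<and> s < l)"
| "registers_below l (Add r s t) = (r < l \<and> s < l \<and> t < l)"
| "registers_below l (Sub r s t) = (r < l \<and> s < l \<and> t < l)"
| "registers_below l (Load r s) = (r < l \<and> s < l)"
| "registers_below l (Store r s) = False"
| "registers_below l (Jump _) = True"
| "registers_below l (JumpEq r s _) = (r < l \<and> s < l)"
| "registers_below l (JumpLess r s _) = (r < l \<and> s < l)"
| "registers_below l (Halt b) = True"

lemma registers_update: "r < length vs \<Longrightarrow> registers (vs[r := x]) = (registers vs)(r := x)"
  by (auto simp: registers_def fun_eq_iff)

lemma halts_Suc:
  assumes "pc < length P" "registers_below (length vs) (P ! pc)"
  shows "halts P mem (Suc t) pc vs b \<longleftrightarrow>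
    exec_list (P ! pc) mem (\<lambda>pc vs. halts P mem t pc vs b) pc vs"
  using assms unfolding halts_def
  by (cases "P ! pc")
    (simp_all add: step_def funpow_Suc_right registers_update registers_def[of vs]
      del: funpow.simps)

text \<open>A halted configuration is a fixed point of \<open>step\<close>. This allows exact step
  counts to be rounded up to uniform bounds.\<close>

lemma halts_mono:
  assumes "halts P mem t pc vs b" "t \<le> t'"
  shows "halts P mem t' pc vs b"
proof -
  obtain d where d: "t' = d + t"
    using assms(2) le_Suc_ex by (metis add.commute)
  obtain pc1 reg1 mem1 where c: "(step P ^^ t) (pc, registers vs, mem) = (pc1, reg1, mem1)"
    using prod_cases3 by blast
  with assms(1) have "step P (pc1, reg1, mem1) = (pc1, reg1, mem1)"
    by (simp add: halts_def step_def)
  then have "(step P ^^ d) (pc1, reg1, mem1) = (pc1, reg1, mem1)"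
    by (induction d) auto
  with assms(1) c show ?thesis
    by (simp add: halts_def d funpow_add)
qed

text \<open>
  Registers: 0 holds 1 and 14 holds 0; 1 and 2 are the end and the start of the encoded words;
  3 and 4 are the start and the end of the word being factorised; 5 is the current position in it
  and 6 the number of greedy steps left; 7 is the furthest end of a match found so far; 8 scans all
  words, and 9 is the end of the word containing it; 10 and 11 walk along the two compared factors;
  12 and 13 are scratch.

  Entry points: 7 finds the end of the input, 14 takes up the next word, 20 the next greedy step,
  25 the next scanned address (which is a length cell if registers 8 and 9 agree), 30 compares
  letters, 39 updates the furthest end.
\<close>

definition program :: ram_program where
  "program =
   [Const 0 1, Load 12 13, Add 2 12 0, Load 12 2, Add 12 12 12, Add 2 2 0, Move 1 2,
    JumpEq 12 14 13, Sub 12 12 0, Load 13 1, Add 1 1 13, Add 1 1 0, Jump 7,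
    Move 3 2,
    JumpEq 3 1 54, Load 12 3, Add 4 3 12, Add 4 4 0, Add 5 3 0, Const 6 3,
    JumpEq 6 14 50, Sub 6 6 0, Move 7 5, Move 8 2, Move 9 2,
    JumpEq 8 1 48, JumpEq 8 9 44, JumpEq 8 5 42, Move 10 5, Move 11 8,
    JumpEq 10 4 39, JumpEq 11 9 39, Load 12 10, Load 13 11, JumpEq 12 13 36, Jump 39,
    Add 10 10 0, Add 11 11 0, Jump 30,
    JumpLess 7 10 41, Jump 42, Move 7 10,
    Add 8 8 0, Jump 25,
    Load 12 8, Add 9 8 12, Add 9 9 0, Jump 42,
    Move 5 7, Jump 20,
    JumpEq 5 4 53, Move 3 4, Jump 14,
    Halt False, Halt True]"

lemma length_program: "length program = 55"
  by (simp add: program_def)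

fun segment :: "(nat \<Rightarrow> nat) \<Rightarrow> nat \<Rightarrow> nat list \<Rightarrow> bool" where
  "segment mem x [] = True"
| "segment mem x (a # s) = (mem x = a \<and> segment mem (Suc x) s)"

lemma segment_append:
  "segment mem x (s @ t) \<longleftrightarrow> segment mem x s \<and> segment mem (x + length s) t"
  by (induction s arbitrary: x) auto

lemma segment_drop: "segment mem x s \<Longrightarrow> d \<le> length s \<Longrightarrow> segment mem (x + d) (drop d s)"
  by (metis append_take_drop_id length_take min.absorb2 segment_append)

abbreviation encode_words :: "nat list list \<Rightarrow> nat list" where
  "encode_words ws \<equiv> concat (map encode_word ws)"

text \<open>An opaque successor, which simplification does not merge with numerals in a time bound.\<close>

definition tick :: "nat \<Rightarrow> nat" where
  "tick = Suc"

lemma program_nth: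
  "program ! 0 = Const 0 1" "program ! Suc 0 = Load 12 13" "program ! 2 = Add 2 12 0"
  "program ! 3 = Load 12 2" "program ! 4 = Add 12 12 12" "program ! 5 = Add 2 2 0"
  "program ! 6 = Move 1 2" "program ! 7 = JumpEq 12 14 13" "program ! 8 = Sub 12 12 0"
  "program ! 9 = Load 13 1" "program ! 10 = Add 1 1 13" "program ! 11 = Add 1 1 0"
  "program ! 12 = Jump 7" "program ! 13 = Move 3 2" "program ! 14 = JumpEq 3 1 54"
  "program ! 15 = Load 12 3" "program ! 16 = Add 4 3 12" "program ! 17 = Add 4 4 0"
  "program ! 18 = Add 5 3 0" "program ! 19 = Const 6 3" "program ! 20 = JumpEq 6 14 50"
  "program ! 21 = Sub 6 6 0" "program ! 22 = Move 7 5" "program ! 23 = Move 8 2"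
  "program ! 24 = Move 9 2" "program ! 25 = JumpEq 8 1 48" "program ! 26 = JumpEq 8 9 44"
  "program ! 27 = JumpEq 8 5 42" "program ! 28 = Move 10 5" "program ! 29 = Move 11 8"
  "program ! 30 = JumpEq 10 4 39" "program ! 31 = JumpEq 11 9 39" "program ! 32 = Load 12 10"
  "program ! 33 = Load 13 11" "program ! 34 = JumpEq 12 13 36" "program ! 35 = Jump 39"
  "program ! 36 = Add 10 10 0" "program ! 37 = Add 11 11 0" "program ! 38 = Jump 30"
  "program ! 39 = JumpLess 7 10 41" "program ! 40 = Jump 42" "program ! 41 = Move 7 10"
  "program ! 42 = Add 8 8 0" "program ! 43 = Jump 25" "program ! 44 = Load 12 8"
  "program ! 45 = Add 9 8 12" "program ! 46 = Add 9 9 0" "program ! 47 = Jump 42"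
  "program ! 48 = Move 5 7" "program ! 49 = Jump 20" "program ! 50 = JumpEq 5 4 53"
  "program ! 51 = Move 3 4" "program ! 52 = Jump 14" "program ! 53 = Halt False"
  "program ! 54 = Halt True"
  by (simp_all add: program_def)

lemma halts_tick:
  assumes "pc < 55" "registers_below (length vs) (program ! pc)"
  shows "halts program mem (tick t) pc vs b \<longleftrightarrow>
    exec_list (program ! pc) mem (\<lambda>pc vs. halts program mem t pc vs b) pc vs"
  unfolding tick_def using assms by (intro halts_Suc) (simp_all add: length_program)

section \<open>Verification of the program\<close>

text \<open>A matching letter costs eight steps, and leaving the loop at most six. The exit is
  assumed for arbitrary registers 11 to 13, whose final contents depend on where the comparison
  stops.\<close>

lemma halts_compare:
  assumes "segment mem x s" "segment mem y t" "e = x + length s" "f = y + length t"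
    and "\<And>u v y'. halts program mem n 39
      [1, E, B, a, e, p, c, best, j, f, x + length (longest_common_prefix s t), y', u, v, 0] b"
  shows "halts program mem (n + 9 * length s + 6) 30
      [1, E, B, a, e, p, c, best, j, f, x, y, u, v, 0] b"
  using assms
proof (induction s t arbitrary: x y u v rule: longest_common_prefix.induct)
  case (1 a' s b' t)
  have mem: "mem x = a'" "mem y = b'" and ne: "x \<noteq> e" "y \<noteq> f"
    using "1.prems"(1-4) by auto
  show ?case
  proof (cases "a' = b'")
    case True
    have "halts program mem (n + 9 * length s + 6) 30
      [1, E, B, a, e, p, c, best, j, f, Suc x, Suc y, a', b', 0] b"
      using "1.prems" True by (intro "1.IH") auto
    then have "halts program mem (tick (tick (tick (tick (tick (tick (tick (tick
        (n + 9 * length s + 6))))))))) 30 [1, E, B, a, e, p, c, best, j, f, x, y, u, v, 0] b"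
      using mem ne True by (simp add: halts_tick program_nth)
    then show ?thesis
      by (rule halts_mono) (simp add: tick_def)
  next
    case False
    then have "halts program mem n 39 [1, E, B, a, e, p, c, best, j, f, x, y, a', b', 0] b"
      using "1.prems"(5)[of y a' b'] by simp
    then have "halts program mem (tick (tick (tick (tick (tick (tick n)))))) 30
        [1, E, B, a, e, p, c, best, j, f, x, y, u, v, 0] b"
      using mem ne False by (simp add: halts_tick program_nth)
    then show ?thesis
      by (rule halts_mono) (simp add: tick_def)
  qed
next
  case ("2_1" t)
  then have "halts program mem (tick n) 30 [1, E, B, a, e, p, c, best, j, f, x, y, u, v, 0] b"
    by (simp add: halts_tick program_nth)
  then show ?case
    by (rule halts_mono) (simp add: tick_def)
next
  case ("2_2" s)
  have n: "halts program mem n 39 [1, E, B, a, e, p, c, best, j, f, x, y, u, v, 0] b"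
    using "2_2"(5)[of y u v] by simp
  show ?case
  \<comment> \<open>\<open>t\<close> is exhausted, but \<open>s\<close> may be empty too, and its
    end is tested first.\<close>
  proof (cases "x = e")
    case True
    with n have "halts program mem (tick n) 30
        [1, E, B, a, e, p, c, best, j, f, x, y, u, v, 0] b"
      by (simp add: halts_tick program_nth)
    then show ?thesis
      by (rule halts_mono) (simp add: tick_def)
  next
    case False
    with n have "halts program mem (tick (tick n)) 30
        [1, E, B, a, e, p, c, best, j, f, x, y, u, v, 0] b"
      using "2_2"(4) by (simp add: halts_tick program_nth)
    then show ?thesis
      by (rule halts_mono) (simp add: tick_def)
  qed
qed

text \<open>\<open>f \<le> E\<close> keeps every letter address \<open>j\<close> below
  \<open>E\<close>, so the test for the end of the text fails inside a word. A letter costs at most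
  the comparison loop plus nine steps.\<close>

lemma halts_scan_word:
  assumes "segment mem p s" "segment mem j t" "e = p + length s" "f = j + length t" "f \<le> E"
    and "\<And>x y u v. halts program mem n 25
      [1, E, B, a, e, p, c, scan_word p s j t best, f, f, x, y, u, v, 0] b"
  shows "halts program mem (n + length t * (9 * length s + 20)) 25
      [1, E, B, a, e, p, c, best, j, f, x, y, u, v, 0] b"
  using assms
proof (induction p s j t best arbitrary: x y u v rule: scan_word.induct)
  case (1 p s j best)
  then show ?case
    by simp
next
  case (2 p s j a' t best)
  define best' where
    "best' = (if j = p then best else max best (p + length (longest_common_prefix s (a' # t))))"
  define m where "m = n + length t * (9 * length s + 20)"
  have ne: "j \<noteq> E" "j \<noteq> f"
    using "2.prems" by auto
  have IH: "halts program mem m 25 [1, E, B, a, e, p, c, best', Suc j, f, x, y, u, v, 0] b"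
    for x y u v
    unfolding m_def best'_def using "2.prems" by (intro "2.IH") auto
  show ?case
  proof (cases "j = p")
    case True
    then have "halts program mem (tick (tick (tick (tick (tick m))))) 25
        [1, E, B, a, e, p, c, best, j, f, x, y, u, v, 0] b"
      using IH ne by (simp add: halts_tick program_nth best'_def)
    then show ?thesis
      by (rule halts_mono) (simp add: tick_def m_def)
  next
    case False
    define z where "z = p + length (longest_common_prefix s (a' # t))"
    \<comment> \<open>Both branches of the update at 39 take four steps to return to 25.\<close>
    have "halts program mem (tick (tick (tick (tick m)))) 39
        [1, E, B, a, e, p, c, best, j, f, z, y, u, v, 0] b" for y u v
    proof (cases "best < z")
      case True
      then have "best' = z"
        using False by (simp add: best'_def z_def)
      then show ?thesis
        using IH[of z y u v] True by (simp add: halts_tick program_nth)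
    next
      case nless: False
      then have "best' = best"
        using False by (simp add: best'_def z_def)
      then show ?thesis
        using IH[of z y u v] nless by (simp add: halts_tick program_nth)
    qed
    then have "halts program mem (tick (tick (tick (tick m))) + 9 * length s + 6) 30
        [1, E, B, a, e, p, c, best, j, f, p, j, u, v, 0] b"
      unfolding z_def using "2.prems" by (intro halts_compare) auto
    then have "halts program mem (tick (tick (tick (tick (tick
        (tick (tick (tick (tick m))) + 9 * length s + 6)))))) 25
        [1, E, B, a, e, p, c, best, j, f, x, y, u, v, 0] b"
      using ne False by (simp add: halts_tick program_nth)
    then show ?thesis
      by (rule halts_mono) (simp add: tick_def m_def)
  qed
qed

lemma length_encode_word [simp]: "length (encode_word w) = Suc (length w)"
  by (simp add: encode_word_def)

lemma segment_encode_word: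
  "segment mem j (encode_word w) \<longleftrightarrow> mem j = length w \<and> segment mem (Suc j) w"
  by (simp add: encode_word_def)

text \<open>The eight steps spent on a length cell are charged to that cell, so each cell of the
  text costs at most \<open>9 * length s + 20\<close>.\<close>

lemma halts_scan:
  assumes "segment mem p s" "segment mem j (encode_words ws)"
    and "e = p + length s" "E = j + length (encode_words ws)"
    and "\<And>x y u v. halts program mem n 48
      [1, E, B, a, e, p, c, scan p s j ws best, E, E, x, y, u, v, 0] b"
  shows "halts program mem (n + length (encode_words ws) * (9 * length s + 20) + 1) 25
      [1, E, B, a, e, p, c, best, j, j, x, y, u, v, 0] b"
  using assms
proof (induction p s j ws best arbitrary: x y u v rule: scan.induct)
  case (1 p s j best)
  then have "halts program mem (tick n) 25 [1, E, B, a, e, p, c, best, j, j, x, y, u, v, 0] b"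
    by (simp add: halts_tick program_nth)
  then show ?case
    by (rule halts_mono) (simp add: tick_def)
next
  case (2 p s j w ws best)
  define f where "f = Suc j + length w"
  define m where "m = n + length (encode_words ws) * (9 * length s + 20) + 1"
  have mem: "mem j = length w" "segment mem (Suc j) w" "segment mem f (encode_words ws)"
    using "2.prems"(2) by (auto simp: segment_append segment_encode_word f_def)
  have "halts program mem m 25
      [1, E, B, a, e, p, c, scan_word p s (Suc j) w best, f, f, x, y, u, v, 0] b" for x y u v
    using "2.IH"[of x y u v] "2.prems" mem unfolding m_def f_def by simp
  then have "halts program mem (m + length w * (9 * length s + 20)) 25
      [1, E, B, a, e, p, c, best, Suc j, f, x, y, u, v, 0] b" for x y u v
    using "2.prems" mem by (intro halts_scan_word) (auto simp: f_def)
  then have "halts program mem (tick (tick (tick (tick (tick (tick (tick (tick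
      (m + length w * (9 * length s + 20)))))))))) 25
      [1, E, B, a, e, p, c, best, j, j, x, y, u, v, 0] b"
    using mem "2.prems" by (simp add: halts_tick program_nth f_def)
  then show ?case
    by (rule halts_mono) (simp add: tick_def m_def algebra_simps)
qed

text \<open>The \<open>8\<close> counts the seven steps around a scan and the final test of the
  scan.\<close>

lemma halts_greedy:
  assumes "segment mem p s" "segment mem B (encode_words ws)"
    and "e = p + length s" "E = B + length (encode_words ws)"
    and "\<And>best j f x y u v. halts program mem n 50
      [1, E, B, a, e, greedy B ws c p s, 0, best, j, f, x, y, u, v, 0] b"
  shows "halts program mem (n + c * (length (encode_words ws) * (9 * length s + 20) + 8) + 1) 20
      [1, E, B, a, e, p, c, best, j, f, x, y, u, v, 0] b"
  using assms
proof (induction c arbitrary: p s best j f x y u v)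
  case 0
  then have "halts program mem (tick n) 20 [1, E, B, a, e, p, 0, best, j, f, x, y, u, v, 0] b"
    by (simp add: halts_tick program_nth)
  then show ?case
    by (rule halts_mono) (simp add: tick_def)
next
  case (Suc c)
  define T where "T = length (encode_words ws) * (9 * length s + 20)"
  define m where "m = n + c * (T + 8) + 1"
  define d where "d = scan p s B ws p - p"
  have p': "scan p s B ws p = p + d" "d \<le> length s"
    using scan_bounds[of p s B ws] by (auto simp: d_def)
  have IH: "halts program mem m 20 [1, E, B, a, e, p + d, c, best, j, f, x, y, u, v, 0] b"
    for best j f x y u v
  proof -
    \<comment> \<open>The rest \<open>drop d s\<close> is not longer than \<open>s\<close>, so the
      bound for \<open>s\<close> serves for all rounds.\<close>
    have "halts program mem
        (n + c * (length (encode_words ws) * (9 * length (drop d s) + 20) + 8) + 1) 20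
        [1, E, B, a, e, p + d, c, best, j, f, x, y, u, v, 0] b"
      using Suc.prems p' by (intro Suc.IH[of "p + d" "drop d s"] segment_drop) auto
    then show ?thesis
      by (rule halts_mono) (simp add: m_def T_def)
  qed
  have "halts program mem (tick (tick m)) 48
      [1, E, B, a, e, p, c, p + d, E, E, x, y, u, v, 0] b" for x y u v
    using IH by (simp add: halts_tick program_nth)
  then have "halts program mem (tick (tick m) + T + 1) 25
      [1, E, B, a, e, p, c, p, B, B, x, y, u, v, 0] b"
    unfolding T_def using Suc.prems(1-4) p' by (intro halts_scan) auto
  then have "halts program mem (tick (tick (tick (tick (tick (tick (tick m) + T + 1)))))) 20
      [1, E, B, a, e, p, Suc c, best, j, f, x, y, u, v, 0] b"
    by (simp add: halts_tick program_nth)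
  then show ?case
    by (rule halts_mono) (simp add: tick_def m_def T_def)
qed

lemma segment_words_Cons:
  "segment mem a (encode_words (w # ws)) \<longleftrightarrow>
     mem a = length w \<and> segment mem (Suc a) w \<and>
     segment mem (Suc (a + length w)) (encode_words ws)"
  by (simp add: encode_word_def segment_append)

lemma halts_Halt: "halts program mem n 53 vs False" "halts program mem n 54 vs True"
proof -
  have "halts program mem 0 53 vs False" "halts program mem 0 54 vs True"
    by (simp_all add: halts_def length_program program_nth)
  then show "halts program mem n 53 vs False" "halts program mem n 54 vs True"
    by (blast intro: halts_mono[OF _ le0])+
qed

text \<open>\<open>vs\<close> holds the words still to be treated, while every scan reads all of
  \<open>ws\<close>; the inclusion carries letter addresses over. A word \<open>w\<close> is charged
  for \<open>length w + 1\<close> cells, each at a cost linear in the whole text, which sums to a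
  quadratic bound.\<close>

lemma halts_words:
  fixes rs :: "nat relation list"
  defines "ws \<equiv> word_list rs"
  assumes rs: "distinct rs" and ws: "segment mem B (encode_words ws)"
    and E: "E = B + length (encode_words ws)"
    and "segment mem a (encode_words vs)" "E = a + length (encode_words vs)"
    and "all_suffixes_at a vs \<subseteq> all_suffixes_at B ws"
  shows "halts program mem
      (length (encode_words vs) * (60 * length (encode_words ws) + 40) + 1) 14
      [1, E, B, a, e, p, c, best, j, f, x, y, u, v, 0] (\<forall>w\<in>set vs. \<not> factorable (set rs) 3 w)"
  using assms(5-)
proof (induction vs arbitrary: a e p c best j f x y u v)
  case Nil
  then have "halts program mem (tick 0) 14 [1, E, B, a, e, p, c, best, j, f, x, y, u, v, 0] True"
    using halts_Halt by (simp add: halts_tick program_nth)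
  then show ?case
    by (simp add: tick_def)
next
  case (Cons w vs)
  let ?b = "\<forall>w\<in>set (w # vs). \<not> factorable (set rs) 3 w"
  define S where "S = length (encode_words ws)"
  define m where "m = length (encode_words vs) * (60 * S + 40) + 1"
  define a' where "a' = Suc (a + length w)"
  have mem: "mem a = length w" "segment mem (Suc a) w" "segment mem a' (encode_words vs)"
    using Cons.prems(1) unfolding segment_words_Cons by (auto simp: a'_def)
  have ne: "a \<noteq> E"
    using Cons.prems(2) by simp
  have "(Suc a, w) \<in> all_suffixes_at B ws \<or> w = []"
    using Cons.prems(3) by (cases w) auto
  then have greedy: "greedy B ws 3 (Suc a) w = a' \<longleftrightarrow> factorable (set rs) 3 w"
    using greedy_eq_end_iff[OF rs, of "Suc a" w B 3] by (simp add: ws_def a'_def)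
  have "halts program mem (tick (tick (tick m))) 50
      [1, E, B, a, a', greedy B ws 3 (Suc a) w, 0, best, j, f, x, y, u, v, 0] ?b"
    for best j f x y u v
  proof (cases "factorable (set rs) 3 w")
    case True
    then show ?thesis
      using greedy halts_Halt by (simp add: halts_tick program_nth)
  next
    case False
    then have b: "?b \<longleftrightarrow> (\<forall>w\<in>set vs. \<not> factorable (set rs) 3 w)"
      by simp
    have "halts program mem m 14
        [1, E, B, a', a', greedy B ws 3 (Suc a) w, 0, best, j, f, x, y, u, v, 0] ?b"
      unfolding b m_def S_def
      using Cons.prems mem by (intro Cons.IH) (auto simp: a'_def)
    then show ?thesis
      using False greedy by (simp add: halts_tick program_nth)
  qed
  then have "halts program mem (tick (tick (tick m)) + 3 * (S * (9 * length w + 20) + 8) + 1) 20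
      [1, E, B, a, a', Suc a, 3, best, j, f, x, y, u, v, 0] ?b" for u v
    unfolding S_def using mem ws E by (intro halts_greedy) (auto simp: a'_def)
  then have "halts program mem (tick (tick (tick (tick (tick (tick
      (tick (tick (tick m)) + 3 * (S * (9 * length w + 20) + 8) + 1))))))) 14
      [1, E, B, a, e, p, c, best, j, f, x, y, u, v, 0] ?b"
    using mem ne by (simp add: halts_tick program_nth a'_def)
  then show ?case
    by (rule halts_mono) (simp add: tick_def m_def S_def algebra_simps)
qed

text \<open>Register 12 counts down the words left to skip. Each skip reads one length cell and
  takes six steps, however long the word is.\<close>

lemma halts_find_end:
  assumes "segment mem a (encode_words ws)"
    and "\<And>v. halts program mem n 13
      [1, a + length (encode_words ws), B, r3, r4, r5, r6, r7, r8, r9, r10, r11, 0, v, 0] b"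
  shows "halts program mem (n + 6 * length ws + 1) 7
      [1, a, B, r3, r4, r5, r6, r7, r8, r9, r10, r11, length ws, v, 0] b"
  using assms
proof (induction ws arbitrary: a v)
  case Nil
  then have "halts program mem (tick n) 7
      [1, a, B, r3, r4, r5, r6, r7, r8, r9, r10, r11, 0, v, 0] b"
    by (simp add: halts_tick program_nth)
  then show ?case
    by (simp add: tick_def)
next
  case (Cons w ws)
  have mem: "mem a = length w" "segment mem (Suc (a + length w)) (encode_words ws)"
    using Cons.prems(1) unfolding segment_words_Cons by auto
  have "halts program mem (n + 6 * length ws + 1) 7
      [1, Suc (a + length w), B, r3, r4, r5, r6, r7, r8, r9, r10, r11, length ws, length w, 0] b"
    using mem Cons.prems(2) by (intro Cons.IH) (auto simp: add.assoc)
  then have "halts program mem (tick (tick (tick (tick (tick (tick (n + 6 * length ws + 1))))))) 7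
      [1, a, B, r3, r4, r5, r6, r7, r8, r9, r10, r11, length (w # ws), v, 0] b"
    using mem by (simp add: halts_tick program_nth)
  then show ?case
    by (rule halts_mono) (simp add: tick_def)
qed

section \<open>Input layout and total running time\<close>

lemma segment_nth: "segment mem x s \<longleftrightarrow> (\<forall>i<length s. mem (x + i) = s ! i)"
  by (induction s arbitrary: x) (auto simp: less_Suc_eq_0_disj)

lemma encode_presentation_eq:
  "encode_presentation as rs = length as # as @ length rs # encode_words (word_list rs)"
proof -
  have "concat (map (\<lambda>(u, v). encode_word u @ encode_word v) rs) = encode_words (word_list rs)"
    by (induction rs) (auto simp: word_list_def)
  then show ?thesis
    by (simp add: encode_presentation_def encode_word_def)
qed

text \<open>Seven initial instructions jump over the alphabet, whatever its size. The term
  \<open>12 * length rs\<close> comes from skipping two words per relation.\<close>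

lemma answers_presentation:
  assumes "distinct rs"
  defines "S \<equiv> length (encode_words (word_list rs))"
  shows "answers_within program (encode_presentation as rs)
    (S * (60 * S + 40) + 12 * length rs + 10) (satisfies_C 4 (set rs))"
proof -
  define mem where
    "mem = (\<lambda>i. if i < length (encode_presentation as rs) then encode_presentation as rs ! i else 0)"
  define ws where "ws = word_list rs"
  \<comment> \<open>The encoded words start after the alphabet, its length cell and the cell with
    the number of relations.\<close>
  define B where "B = Suc (Suc (length as))"
  define b where "b \<longleftrightarrow> (\<forall>w\<in>set ws. \<not> factorable (set rs) 3 w)"
  have b: "b \<longleftrightarrow> satisfies_C 4 (set rs)"
    using satisfies_C_Suc[of 3 "set rs"] by (simp add: b_def ws_def set_word_list)
  have "segment mem 0 (encode_presentation as rs)"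
    by (simp add: segment_nth mem_def)
  then have mem: "mem 0 = length as" "mem (Suc (length as)) = length rs"
      "segment mem B (encode_words ws)"
    by (simp_all add: encode_presentation_eq segment_append B_def ws_def)
  define n where "n = S * (60 * S + 40) + 1"
  have "halts program mem n 14 [1, B + S, B, B, 0, 0, 0, 0, 0, 0, 0, 0, 0, v, 0] b" for v
    unfolding n_def b_def S_def ws_def
    using assms(1) mem(3) by (intro halts_words) (auto simp: ws_def)
  then have "halts program mem (tick n) 13 [1, B + S, B, 0, 0, 0, 0, 0, 0, 0, 0, 0, 0, v, 0] b" for v
    by (simp add: halts_tick program_nth)
  then have "halts program mem (tick n + 6 * length ws + 1) 7
      [1, B, B, 0, 0, 0, 0, 0, 0, 0, 0, 0, length ws, 0, 0] b"
    using mem(3) by (intro halts_find_end) (auto simp: S_def ws_def)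
  then have "halts program mem
      (tick (tick (tick (tick (tick (tick (tick (tick n + 6 * length ws + 1)))))))) 0
      [0, 0, 0, 0, 0, 0, 0, 0, 0, 0, 0, 0, 0, 0, 0] b"
    using mem(1,2) by (simp add: halts_tick program_nth B_def ws_def mult_2 flip: numeral_2_eq_2)
  then have "halts program mem (S * (60 * S + 40) + 12 * length rs + 10) 0
      [0, 0, 0, 0, 0, 0, 0, 0, 0, 0, 0, 0, 0, 0, 0] b"
    by (rule halts_mono) (simp add: tick_def n_def ws_def)
  moreover have "registers [0, 0, 0, 0, 0, 0, 0, 0, 0, 0, 0, 0, 0, 0, 0] = (\<lambda>_. 0)"
    by (auto simp: registers_def fun_eq_iff less_Suc_eq_0_disj numeral_eq_Suc)
  ultimately show ?thesis
    by (simp add: b halts_def answers_within_def initial_config_def mem_def)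
qed

text \<open>Each relation adds two length cells to its letters; \<open>distinct rs\<close> makes the
  sum over the set agree with that over the list.\<close>

lemma length_encode_words_word_list:
  "distinct rs \<Longrightarrow> length (encode_words (word_list rs)) = relations_length (set rs) + 2 * length rs"
proof (induction rs)
  case (Cons r rs)
  then show ?case
    by (cases r) (auto simp: word_list_def relations_length_def)
qed (simp add: word_list_def relations_length_def)

text \<open>Each relation other than \<open>([], [])\<close> contributes at least one letter, and a
  set contains that exception at most once.\<close>

lemma card_relations_le: "finite R \<Longrightarrow> card R \<le> Suc (relations_length R)"
proof -
  assume R: "finite R"
  have "card (R - {([], [])}) \<le> relations_length (R - {([], [])})"
    unfolding relations_length_def card_eq_sum
    by (rule sum_mono) (auto simp: Suc_le_eq)
  also have "\<dots> \<le> relations_length R"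
    unfolding relations_length_def using R by (intro sum_mono2) auto
  finally show ?thesis
    using card_Diff1_le card_Suc_Diff1[OF R, of "([], [])"]
    by (cases "([], []) \<in> R") auto
qed

lemma answers_within_mono:
  assumes "answers_within P input t b" "t \<le> t'"
  shows "answers_within P input t' b"
proof -
  have "registers [] = (\<lambda>_. 0)"
    by (simp add: registers_def fun_eq_iff)
  then have "answers_within P input t b \<longleftrightarrow>
      halts P (\<lambda>i. if i < length input then input ! i else 0) t 0 [] b" for t
    by (simp add: answers_within_def halts_def initial_config_def)
  then show ?thesis
    using assms halts_mono by blast
qed

theorem corollary5:
  "\<exists>(P :: ram_program) (c :: nat). \<forall>(A :: nat set) (R :: nat relation set) (input :: nat list).
     finite_presentation A R \<longrightarrow> encodes_presentation input A R \<longrightarrow>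
     answers_within P input (c * (max 1 (relations_length R))\<^sup>2) (satisfies_C 4 R)"
proof (intro exI allI impI)
  fix A :: "nat set" and R :: "nat relation set" and input :: "nat list"
  assume "encodes_presentation input A R"
  then obtain as rs where rs: "distinct rs" "set rs = R" "input = encode_presentation as rs"
    by (auto simp: encodes_presentation_def)
  define M where "M = max 1 (relations_length R)"
  define S where "S = length (encode_words (word_list rs))"
  have M: "1 \<le> M" "relations_length R \<le> M"
    by (simp_all add: M_def)
  have len: "length rs \<le> Suc (relations_length R)"
    using card_relations_le[of R] rs distinct_card by fastforce
  then have m: "length rs \<le> 2 * M"
    using M by linarith
  \<comment> \<open>Two length cells per relation give at most \<open>M + 2 * (M + 1)\<close>, and
    \<open>M\<close> is positive.\<close>
  have "S \<le> 5 * M"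
    using M len length_encode_words_word_list[OF rs(1)] rs(2)
    unfolding S_def by simp
  then have "S * (60 * S + 40) \<le> 5 * M * (60 * (5 * M) + 40)"
    by (intro mult_mono) auto
  also have "\<dots> = 1500 * (M * M) + 200 * M"
    by (simp add: algebra_simps)
  finally have "S * (60 * S + 40) + 12 * length rs + 10 \<le> 1500 * (M * M) + 224 * M + 10"
    using m by linarith
  \<comment> \<open>Since \<open>1 \<le> M\<close>, the lower terms are absorbed:
    \<open>1734 = 1500 + 224 + 10\<close>, the constant \<open>c\<close>.\<close>
  also have "\<dots> \<le> 1734 * (M * M)"
  proof -
    have "M \<le> M * M"
      by simp
    then show ?thesis
      using M by linarith
  qed
  finally have "S * (60 * S + 40) + 12 * length rs + 10 \<le> 1734 * M\<^sup>2"
    by (simp add: power2_eq_square)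
  then show "answers_within program input (1734 * (max 1 (relations_length R))\<^sup>2) (satisfies_C 4 R)"
    using answers_presentation[OF rs(1), of as] answers_within_mono rs
    unfolding S_def M_def by blast
qed

end
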